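(* Let $k$ be an integer and let $a\in\mathbb{C}\setminus\{0,-1,-2,\ldots\}$. The $m$-Hurwitz type poly-Bernoulli numbers satisfy, for all integers $n,m\ge 0$, the three-term recurrence relation $$\mathbb{B}_{n+1,m}^{(k)}(a)=\frac{(m+1)(m+a)^{k}}{(m+a+1)^{k}}\,\mathbb{B}_{n,m+1}^{(k)}(a)-m\,\mathbb{B}_{n,m}^{(k)}(a),$$ with the initial sequence given by $\mathbb{B}_{0,m}^{(k)}(a)=\dfrac{1}{a^{k}}$ for all $m\ge 0$.
   Context: Convention: $0^0=1$. For integers $n,i\ge 0$ the weighted Stirling numbers of the second kind are $\mathcal{S}_n^i(x)=\frac{1}{i!}\sum_{j=0}^{i}(-1)^{i-j}\binom{i}{j}(x+j)^n$. For integers $n,i,m\ge 0$, the $r$-Stirling numbers of the second kind (with $r=m$) satisfy ${n+m \brace i+m}_m=\mathcal{S}_n^i(m)$. For an integer $k$, integers $n,m\ge0$ and $a\in\mathbb{C}\setminus\{0,-1,-2,\ldots\}$, the $m$-Hurwitz type poly-Bernoulli numbers are defined by $$\mathbb{B}_{n,m}^{(k)}(a)=\frac{(m+a)^k}{m!\,a^k}\sum_{i=0}^{n}{n+m \brace i+m}_m\frac{(-1)^{n-i}(i+m)!}{(i+m+a)^k}.$$ *)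

theory Defs
  imports Complex_Main "HOL-Library.Disjoint_Sets" "HOL-Library.Nonpos_Ints"
begin

definition weighted_stirling :: "nat \<Rightarrow> nat \<Rightarrow> 'a \<Rightarrow> 'a :: field_char_0" where
  "weighted_stirling n i x =
     (\<Sum>j\<le>i. (-1) ^ (i - j) * of_nat (i choose j) * (x + of_nat j) ^ n) / fact i"

text \<open>
  The objects counted by Broder's \<open>r\<close>-Stirling numbers: partitions of \<open>{1..n}\<close> into \<open>k\<close> nonempty blocks such that
  \<open>1, \<dots>, r\<close> lie in distinct blocks. Broder's definition concerns the range \<open>r \<le> n\<close>;
  outside it the condition only restricts the elements of \<open>{1..n}\<close>.
\<close>

definition r_stirling_partitions :: "nat \<Rightarrow> nat \<Rightarrow> nat \<Rightarrow> nat set set set" where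
  "r_stirling_partitions r n k =
     {P. partition_on {1..n} P \<and> card P = k \<and>
         (\<forall>B\<in>P. \<forall>u\<in>B. \<forall>v\<in>B. u \<le> r \<and> v \<le> r \<longrightarrow> u = v)}"

definition r_stirling2 :: "nat \<Rightarrow> nat \<Rightarrow> nat \<Rightarrow> nat" where
  "r_stirling2 r n k = card (r_stirling_partitions r n k)"

definition hurwitz_poly_bernoulli :: "nat \<Rightarrow> nat \<Rightarrow> int \<Rightarrow> complex \<Rightarrow> complex" where
  "hurwitz_poly_bernoulli n m k a =
     (of_nat m + a) powi k / (fact m * a powi k) *
     (\<Sum>i\<le>n. of_nat (r_stirling2 m (n + m) (i + m)) *
        ((-1) ^ (n - i) * fact (i + m) / (of_nat (i + m) + a) powi k))"

lemma finite_r_stirling_partitions: "finite (r_stirling_partitions r n k)"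
  by (rule finite_subset[OF _ finitely_many_partition_on[of "{1..n}"]])
     (auto simp: r_stirling_partitions_def)

lemma r_stirling2_diag: "r_stirling2 r r k = (if k = r then 1 else 0)"
proof -
  let ?S = "(\<lambda>u. {u}) ` {1..r}"
  have S: "partition_on {1..r} ?S"
    by (auto simp: partition_on_def disjoint_def)
  have c: "card ?S = r" by (subst card_image) auto
  have eq: "P = ?S" if P: "partition_on {1..r} P"
    and d: "\<forall>B\<in>P. \<forall>u\<in>B. \<forall>v\<in>B. u \<le> r \<and> v \<le> r \<longrightarrow> u = v" for P
  proof -
    have un: "\<Union>P = {1..r}" and ne: "{} \<notin> P" using P by (auto simp: partition_on_def)
    have sing: "B = {u}" if "B \<in> P" "u \<in> B" for B u
    proof -
      have "B \<subseteq> {1..r}" using un that by blast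
      thus ?thesis using d that by fastforce
    qed
    show ?thesis
    proof (intro equalityI subsetI)
      fix B assume B: "B \<in> P"
      then obtain u where u: "u \<in> B" using ne by (metis equals0I)
      have "u \<in> {1..r}" using un B u by blast
      thus "B \<in> ?S" using sing[OF B u] by blast
    next
      fix B assume "B \<in> ?S"
      then obtain u where u: "B = {u}" "u \<in> {1..r}" by blast
      then obtain C where "C \<in> P" "u \<in> C" using un by blast
      thus "B \<in> P" using sing u by metis
    qed
  qed
  have d: "\<forall>B\<in>?S. \<forall>u\<in>B. \<forall>v\<in>B. u \<le> r \<and> v \<le> r \<longrightarrow> u = v" by blast
  have "P \<in> r_stirling_partitions r r k \<longleftrightarrow> P = ?S \<and> k = r" for P
  proof
    assume P: "P \<in> r_stirling_partitions r r k"
    hence "P = ?S" by (intro eq) (simp_all add: r_stirling_partitions_def)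
    moreover have "card P = k" using P by (simp add: r_stirling_partitions_def)
    ultimately show "P = ?S \<and> k = r" using c by blast
  next
    assume "P = ?S \<and> k = r"
    thus "P \<in> r_stirling_partitions r r k"
      unfolding r_stirling_partitions_def using S c d by blast
  qed
  hence "r_stirling_partitions r r k = (if k = r then {?S} else {})" by (cases "k = r") auto
  thus ?thesis by (simp add: r_stirling2_def)
qed

lemma r_stirling2_Suc:
  assumes "r \<le> n"
  shows "r_stirling2 r (Suc n) k =
           k * r_stirling2 r n k + (if k = 0 then 0 else r_stirling2 r n (k - 1))"
proof -
  let ?x = "Suc n"
  define good where
    "good = (\<lambda>P :: nat set set. \<forall>B\<in>P. \<forall>u\<in>B. \<forall>v\<in>B. u \<le> r \<and> v \<le> r \<longrightarrow> u = v)"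
  have RSP: "P \<in> r_stirling_partitions r n' k' \<longleftrightarrow> partition_on {1..n'} P \<and> card P = k' \<and> good P"
    for P n' k' by (simp add: r_stirling_partitions_def good_def)
  define f where "f = (\<lambda>(P, B). insert (insert ?x B) (P - {B}))"
  define A where "A = {P \<in> r_stirling_partitions r (Suc n) k. {?x} \<in> P}"
  define C where "C = {P \<in> r_stirling_partitions r (Suc n) k. {?x} \<notin> P}"
  have xr: "\<not> ?x \<le> r" using assms by simp
  have fin: "finite P" if "partition_on {1..n'} P" for P :: "nat set set" and n'
    using finite_elements[OF _ that] by simp
  have iv: "{1..Suc n} = insert ?x {1..n}" by auto
  have nx: "?x \<notin> B" if "partition_on {1..n} P" "B \<in> P" for P B
  proof
    assume "?x \<in> B"
    hence "?x \<in> {1..n}" using that partition_onD1[OF that(1)] by blast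
    thus False by simp
  qed
  have split: "r_stirling2 r (Suc n) k = card A + card C"
  proof -
    have "r_stirling_partitions r (Suc n) k = A \<union> C" "A \<inter> C = {}"
      by (auto simp: A_def C_def)
    moreover have "finite A" "finite C"
      using finite_r_stirling_partitions[of r "Suc n" k] by (auto simp: A_def C_def)
    ultimately show ?thesis by (simp add: r_stirling2_def card_Un_disjoint)
  qed
  have cA: "card A = (if k = 0 then 0 else r_stirling2 r n (k - 1))"
  proof (cases "k = 0")
    case True
    have "A = {}" using fin unfolding A_def RSP True by fastforce
    thus ?thesis using True by simp
  next
    case False
    have "bij_betw (\<lambda>P. P - {{?x}}) A (r_stirling_partitions r n (k - 1))"
    proof (rule bij_betwI[where g = "insert {?x}"])
      show "(\<lambda>P. P - {{?x}}) \<in> A \<rightarrow> r_stirling_partitions r n (k - 1)"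
      proof
        fix P assume "P \<in> A"
        hence P: "partition_on {1..Suc n} P" "card P = k" "good P" "{?x} \<in> P"
          by (auto simp: A_def RSP)
        have un: "\<Union>P = {1..Suc n}"
          and dj: "\<And>X Y. X \<in> P \<Longrightarrow> Y \<in> P \<Longrightarrow> X \<noteq> Y \<Longrightarrow> X \<inter> Y = {}"
          using P(1) by (auto simp: partition_on_def disjoint_def)
        have "?x \<notin> X" if "X \<in> P - {{?x}}" for X
          using dj[of X "{?x}"] P(4) that by blast
        hence "\<Union>(P - {{?x}}) = {1..Suc n} - {?x}" unfolding un[symmetric] by blast
        also have "\<dots> = {1..n}" by auto
        finally have "\<Union>(P - {{?x}}) = {1..n}" .
        hence "partition_on {1..n} (P - {{?x}})"
          using P(1) unfolding partition_on_def disjoint_def by blast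
        moreover have "card (P - {{?x}}) = k - 1" using P by simp
        moreover have "good (P - {{?x}})" using P(3) by (auto simp: good_def)
        ultimately show "P - {{?x}} \<in> r_stirling_partitions r n (k - 1)" by (simp add: RSP)
      qed
      show "insert {?x} \<in> r_stirling_partitions r n (k - 1) \<rightarrow> A"
      proof
        fix P assume "P \<in> r_stirling_partitions r n (k - 1)"
        hence P: "partition_on {1..n} P" "card P = k - 1" "good P" by (auto simp: RSP)
        have "partition_on {1..Suc n} (insert {?x} P)"
          unfolding iv using P(1) nx[OF P(1)] by (auto simp: partition_on_def disjoint_def)
        moreover have "card (insert {?x} P) = k"
          using nx[OF P(1)] fin[OF P(1)] P(2) False by (subst card_insert_disjoint) auto
        moreover have "good (insert {?x} P)" using P(3) by (auto simp: good_def)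
        ultimately show "insert {?x} P \<in> A" by (simp add: A_def RSP)
      qed
      show "insert {?x} (P - {{?x}}) = P" if "P \<in> A" for P
        using that by (auto simp: A_def)
      show "insert {?x} P - {{?x}} = P" if "P \<in> r_stirling_partitions r n (k - 1)" for P
        using that nx[of P "{?x}"] by (auto simp: RSP)
    qed
    thus ?thesis using False by (simp add: bij_betw_same_card r_stirling2_def)
  qed
  have cC: "card C = k * r_stirling2 r n k"
  proof -
    let ?D = "Sigma (r_stirling_partitions r n k) (\<lambda>P. P)"
    have inj: "inj_on f ?D"
    proof (rule inj_on_inverseI[where
          g = "\<lambda>Q. let E = (THE E. E \<in> Q \<and> ?x \<in> E) in (insert (E - {?x}) (Q - {E}), E - {?x})"])
      fix PB assume "PB \<in> ?D"
      then obtain P B where PB: "PB = (P, B)" "partition_on {1..n} P" "B \<in> P"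
        by (auto simp: RSP)
      note nx' = nx[OF PB(2)]
      have "(THE E. E \<in> f PB \<and> ?x \<in> E) = insert ?x B"
        using nx' PB(3) by (intro the_equality) (auto simp: f_def PB(1))
      moreover have "insert ?x B - {?x} = B" using nx'[OF PB(3)] by blast
      moreover have "insert ?x B \<notin> P" using nx' by blast
      ultimately show "(let E = (THE E. E \<in> f PB \<and> ?x \<in> E)
          in (insert (E - {?x}) (f PB - {E}), E - {?x})) = PB"
        using PB(3) by (auto simp: f_def PB(1) Let_def)
    qed
    have img: "f ` ?D = C"
    proof (intro equalityI subsetI)
      fix Q assume "Q \<in> f ` ?D"
      then obtain P B where P: "partition_on {1..n} P" "card P = k" "good P" "B \<in> P"
        and Q: "Q = insert (insert ?x B) (P - {B})"
        by (auto simp: RSP f_def)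
      note nx' = nx[OF P(1)]
      have un: "\<Union>P = {1..n}" and ne: "{} \<notin> P"
        and dj: "\<And>X Y. X \<in> P \<Longrightarrow> Y \<in> P \<Longrightarrow> X \<noteq> Y \<Longrightarrow> X \<inter> Y = {}"
        using P(1) by (auto simp: partition_on_def disjoint_def)
      have "\<Union>Q = insert ?x (\<Union>P)" using P(4) Q by blast
      moreover have "{} \<notin> Q" using ne Q by auto
      moreover have "disjoint Q"
        unfolding disjoint_def
      proof (intro ballI impI)
        fix X Y assume XY: "X \<in> Q" "Y \<in> Q" "X \<noteq> Y"
        have *: "insert ?x B \<inter> Z = {}" if "Z \<in> P" "Z \<noteq> B" for Z
          using dj[OF that(1) P(4) that(2)] nx'[OF that(1)] by blast
        show "X \<inter> Y = {}"
          using XY *[of X] *[of Y] dj[of X Y] unfolding Q by blast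
      qed
      ultimately have "partition_on {1..Suc n} Q"
        unfolding iv un[symmetric] partition_on_def by blast
      moreover have "card Q = k"
      proof -
        have "insert ?x B \<notin> P - {B}" using nx' by blast
        hence "card Q = Suc (card (P - {B}))" using fin[OF P(1)] Q by simp
        also have "\<dots> = card P" using P(4) fin[OF P(1)] by (metis card_Suc_Diff1)
        finally show ?thesis using P(2) by simp
      qed
      moreover have "good Q" using P(3,4) xr unfolding good_def Q by auto
      moreover have "{?x} \<notin> Q"
      proof
        assume "{?x} \<in> Q"
        hence "insert ?x B = {?x}" using nx'[of "{?x}"] Q by auto
        hence "B = {}" using nx'[OF P(4)] by auto
        thus False using P(4) ne by simp
      qed
      ultimately show "Q \<in> C" by (simp add: C_def RSP)
    next
      fix Q assume "Q \<in> C"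
      hence Q: "partition_on {1..Suc n} Q" "card Q = k" "good Q" "{?x} \<notin> Q"
        by (auto simp: C_def RSP)
      have un: "\<Union>Q = {1..Suc n}" and ne: "{} \<notin> Q"
        and dj: "\<And>X Y. X \<in> Q \<Longrightarrow> Y \<in> Q \<Longrightarrow> X \<noteq> Y \<Longrightarrow> X \<inter> Y = {}"
        using Q(1) by (auto simp: partition_on_def disjoint_def)
      have "?x \<in> \<Union>Q" unfolding un by simp
      then obtain E where E: "E \<in> Q" "?x \<in> E" by blast
      define B where "B = E - {?x}"
      define P where "P = insert B (Q - {E})"
      have EB: "E = insert ?x B" "?x \<notin> B" using E(2) by (auto simp: B_def)
      have Bne: "B \<noteq> {}" using E Q(4) EB by auto
      have nE: "?x \<notin> X" if "X \<in> Q" "X \<noteq> E" for X using dj[OF that(1) E(1) that(2)] E(2) by blast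
      have BQ: "B \<notin> Q - {E}"
      proof
        assume "B \<in> Q - {E}"
        hence "B \<inter> E = {}" using dj E(1) by blast
        thus False using EB(1) Bne by blast
      qed
      have "\<Union>P = \<Union>Q - {?x}"
        unfolding P_def B_def using nE E(1) by blast
      also have "\<dots> = {1..n}" unfolding un by auto
      finally have "\<Union>P = {1..n}" .
      moreover have "{} \<notin> P" using ne Bne by (auto simp: P_def)
      moreover have "disjoint P"
        unfolding disjoint_def
      proof (intro ballI impI)
        fix X Y assume XY: "X \<in> P" "Y \<in> P" "X \<noteq> Y"
        have *: "B \<inter> Z = {}" if "Z \<in> Q" "Z \<noteq> E" for Z
          using dj[OF that(1) E(1) that(2)] unfolding B_def by blast
        show "X \<inter> Y = {}"
          using XY *[of X] *[of Y] dj[of X Y] unfolding P_def by blast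
      qed
      ultimately have "partition_on {1..n} P" unfolding partition_on_def by simp
      moreover have "card P = k"
      proof -
        have "card P = Suc (card (Q - {E}))" using BQ fin[OF Q(1)] by (simp add: P_def)
        also have "\<dots> = card Q" using E(1) fin[OF Q(1)] by (metis card_Suc_Diff1)
        finally show ?thesis using Q(2) by simp
      qed
      moreover have "good P" using Q(3) E(1) unfolding good_def P_def B_def by blast
      ultimately have "(P, B) \<in> ?D" by (simp add: RSP P_def)
      moreover have "f (P, B) = Q"
        using BQ EB E(1) by (auto simp: f_def P_def)
      ultimately show "Q \<in> f ` ?D" by (metis imageI)
    qed
    have "card C = card ?D" using card_image[OF inj] img by simp
    also have "\<dots> = (\<Sum>P\<in>r_stirling_partitions r n k. card P)"
      using fin by (intro card_SigmaI finite_r_stirling_partitions) (auto simp: RSP)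
    also have "\<dots> = (\<Sum>P\<in>r_stirling_partitions r n k. k)"
      by (intro sum.cong) (auto simp: RSP)
    finally show ?thesis by (simp add: r_stirling2_def)
  qed
  show ?thesis using split cA cC by simp
qed

lemma r_stirling2_less: "k < r \<Longrightarrow> r_stirling2 r (n + r) k = 0"
  by (induction n arbitrary: k) (auto simp: r_stirling2_diag r_stirling2_Suc)

lemma weighted_stirling_0: "weighted_stirling 0 i x = (if i = 0 then 1 else 0)"
proof -
  have "(\<Sum>j\<le>i. of_nat (i choose j) * 1 ^ j * (-1) ^ (i - j)) = (1 + (-1 :: 'a)) ^ i"
    by (rule binomial_ring[symmetric])
  thus ?thesis by (simp add: weighted_stirling_def mult.commute power_0_left)
qed

lemma weighted_stirling_Suc_0:
  "weighted_stirling (Suc n) 0 x = x * weighted_stirling n 0 x"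
  by (simp add: weighted_stirling_def)

lemma weighted_stirling_Suc_Suc:
  fixes x :: "'a :: field_char_0"
  shows "weighted_stirling (Suc n) (Suc i) x =
           (x + of_nat (Suc i)) * weighted_stirling n (Suc i) x + weighted_stirling n i x"
proof -
  define t where "t = (\<lambda>j. (-1) ^ (Suc i - j) * of_nat (Suc i choose j) * (x + of_nat j) ^ n)"
  define s where "s = (\<lambda>j. (-1) ^ (i - j) * of_nat (i choose j) * (x + of_nat j) ^ n)"
  have step: "t j * (of_nat j - of_nat (Suc i)) = of_nat (Suc i) * s j" if "j \<le> i" for j
  proof -
    have "(Suc i - j) * (Suc i choose j) = Suc i * (i choose j)"
      using binomial_absorb_comp[of "Suc i" j] that by simp
    hence *: "(of_nat (Suc i) - of_nat j) * of_nat (Suc i choose j) =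
        of_nat (Suc i) * (of_nat (i choose j) :: 'a)"
      using that by (metis of_nat_diff of_nat_mult le_SucI)
    have "t j * (of_nat j - of_nat (Suc i)) = (-1) ^ (i - j) *
        ((of_nat (Suc i) - of_nat j) * of_nat (Suc i choose j)) * (x + of_nat j) ^ n"
      using that by (simp add: t_def Suc_diff_le algebra_simps)
    thus ?thesis unfolding * s_def by (simp only: mult_ac)
  qed
  have "(\<Sum>j\<le>Suc i. t j * (x + of_nat j)) =
      (\<Sum>j\<le>Suc i. (x + of_nat (Suc i)) * t j + t j * (of_nat j - of_nat (Suc i)))"
    by (intro sum.cong) (auto simp: algebra_simps)
  also have "\<dots> = (x + of_nat (Suc i)) * sum t {..Suc i}
      + (\<Sum>j\<le>Suc i. t j * (of_nat j - of_nat (Suc i)))"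
    by (simp only: sum.distrib sum_distrib_left)
  also have "(\<Sum>j\<le>Suc i. t j * (of_nat j - of_nat (Suc i))) = of_nat (Suc i) * sum s {..i}"
    using step by (simp add: sum_distrib_left del: of_nat_Suc)
  finally have main: "(\<Sum>j\<le>Suc i. t j * (x + of_nat j)) =
    (x + of_nat (Suc i)) * sum t {..Suc i} + of_nat (Suc i) * sum s {..i}" .
  have W1: "weighted_stirling (Suc n) (Suc i) x = (\<Sum>j\<le>Suc i. t j * (x + of_nat j)) / fact (Suc i)"
    unfolding weighted_stirling_def t_def by (simp only: power_Suc mult_ac)
  have W2: "weighted_stirling n (Suc i) x = sum t {..Suc i} / fact (Suc i)"
    unfolding weighted_stirling_def t_def ..
  have W3: "weighted_stirling n i x = of_nat (Suc i) * sum s {..i} / fact (Suc i)"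
    unfolding weighted_stirling_def s_def fact_Suc by (simp del: of_nat_Suc)
  show ?thesis unfolding W1 W2 W3 main by (simp only: add_divide_distrib times_divide_eq_right)
qed

theorem r_stirling2_eq_weighted_stirling:
  "of_nat (r_stirling2 m (n + m) (i + m)) =
     (weighted_stirling n i (of_nat m) :: 'a :: field_char_0)"
proof (induction n arbitrary: i)
  case 0
  show ?case by (simp add: r_stirling2_diag weighted_stirling_0)
next
  case (Suc n)
  show ?case
  proof (cases i)
    case 0
    have "r_stirling2 m (Suc (n + m)) m = m * r_stirling2 m (n + m) m"
      using r_stirling2_less[of "m - 1" m n] by (subst r_stirling2_Suc) auto
    thus ?thesis using Suc.IH[of 0] 0 by (simp add: weighted_stirling_Suc_0)
  next
    case (Suc l)
    have "r_stirling2 m (Suc (n + m)) (Suc l + m) =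
        (Suc l + m) * r_stirling2 m (n + m) (Suc l + m) + r_stirling2 m (n + m) (l + m)"
      by (subst r_stirling2_Suc) auto
    hence "of_nat (r_stirling2 m (Suc n + m) (i + m)) =
        (of_nat m + of_nat (Suc l)) * (of_nat (r_stirling2 m (n + m) (Suc l + m)) :: 'a)
        + of_nat (r_stirling2 m (n + m) (l + m))"
      using Suc by (simp add: algebra_simps)
    thus ?thesis
      unfolding Suc.IH Suc weighted_stirling_Suc_Suc by simp
  qed
qed

end

theory Submission
  imports Defs
begin

text \<open>
  Writing \<open>x + j\<close> for one factor of \<open>(x + j)^(n+1)\<close> and absorbing \<open>j\<close> into the binomial
  coefficient gives \<open>S_{n+1}^i(x) = x S_n^i(x) + S_n^{i-1}(x+1)\<close>. Inserted into the defining sum of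
  the poly-Bernoulli number at \<open>(n+1, m)\<close>, the first term reproduces, up to the sign, the sum at
  \<open>(n, m)\<close>, because \<open>S_n^{n+1} = 0\<close>; the second term is, after shifting the index, the sum at
  \<open>(n, m+1)\<close>.
\<close>

lemma weighted_stirling_eq_0: "n < i \<Longrightarrow> weighted_stirling n i x = 0"
proof (induction n arbitrary: i)
  case 0
  then show ?case by (simp add: weighted_stirling_0)
next
  case (Suc n)
  then show ?case by (cases i) (auto simp: weighted_stirling_Suc_Suc)
qed

text \<open>Induction replaces the manipulation of binomial sums: expand by
  \<open>weighted_stirling_Suc_Suc\<close> and apply the hypothesis. The multiples of x regroup to
  the recurrence at x, the rest to the one at x + 1, because x + (i + 1) = (x + 1) + i.\<close>

lemma weighted_stirling_Suc_Suc_shift: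
  fixes x :: "'a :: field_char_0"
  shows "weighted_stirling (Suc n) (Suc i) x =
           x * weighted_stirling n (Suc i) x + weighted_stirling n i (x + 1)"
proof (induction n arbitrary: i)
  case 0
  show ?case by (simp only: weighted_stirling_Suc_Suc weighted_stirling_0) simp
next
  case (Suc n)
  have eq: "weighted_stirling (Suc (Suc n)) (Suc i) x =
      (x + of_nat (Suc i)) * (x * weighted_stirling n (Suc i) x + weighted_stirling n i (x + 1))
      + weighted_stirling (Suc n) i x"
    by (subst weighted_stirling_Suc_Suc) (simp only: Suc.IH)
  show ?case
  \<comment> \<open>The remaining term has lower index i; for i = 0 the shift identity does not
    cover it, and it is just x times its predecessor.\<close>
  proof (cases i)
    case 0
    show ?thesis
      unfolding eq
      by (simp add: 0 weighted_stirling_Suc_0 weighted_stirling_Suc_Suc algebra_simps)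
  next
    case (Suc l)
    have "weighted_stirling (Suc n) i x =
        x * weighted_stirling n i x + weighted_stirling n l (x + 1)"
      unfolding Suc by (rule Suc.IH)
    then show ?thesis
      unfolding eq by (simp add: Suc weighted_stirling_Suc_Suc algebra_simps)
  qed
qed

text \<open>The weights \<open>c\<close> stay arbitrary because only the signs and the index shift
  matter.\<close>

lemma sum_weighted_stirling_Suc:
  fixes x :: "'a :: field_char_0"
  shows "(\<Sum>i\<le>Suc n. weighted_stirling (Suc n) i x * ((-1) ^ (Suc n - i) * c i)) =
           (\<Sum>i\<le>n. weighted_stirling n i (x + 1) * ((-1) ^ (n - i) * c (Suc i)))
           - x * (\<Sum>i\<le>n. weighted_stirling n i x * ((-1) ^ (n - i) * c i))"
proof -
  have "(\<Sum>i\<le>Suc n. weighted_stirling (Suc n) i x * ((-1) ^ (Suc n - i) * c i)) =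
      x * (\<Sum>i\<le>Suc n. weighted_stirling n i x * ((-1) ^ (Suc n - i) * c i))
      + (\<Sum>i\<le>n. weighted_stirling n i (x + 1) * ((-1) ^ (n - i) * c (Suc i)))"
    unfolding sum.atMost_Suc_shift
    by (simp add: weighted_stirling_Suc_0 weighted_stirling_Suc_Suc_shift
        algebra_simps sum.distrib sum_distrib_left)
  also have "(\<Sum>i\<le>Suc n. weighted_stirling n i x * ((-1) ^ (Suc n - i) * c i)) =
      (\<Sum>i\<le>n. weighted_stirling n i x * ((-1) ^ (Suc n - i) * c i))"
    by (simp add: weighted_stirling_eq_0)
  \<comment> \<open>For i \<le> n the exponent exceeds n - i by one, hence the minus sign.\<close>
  also have "\<dots> = - (\<Sum>i\<le>n. weighted_stirling n i x * ((-1) ^ (n - i) * c i))"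
    by (simp add: sum_negf[symmetric] Suc_diff_le)
  finally show ?thesis by simp
qed

lemma hurwitz_poly_bernoulli_eq_weighted_stirling:
  "hurwitz_poly_bernoulli n m k a =
     (of_nat m + a) powi k / (fact m * a powi k) *
     (\<Sum>i\<le>n. weighted_stirling n i (of_nat m) *
        ((-1) ^ (n - i) * (fact (i + m) / (of_nat (i + m) + a) powi k)))"
  by (simp add: hurwitz_poly_bernoulli_def r_stirling2_eq_weighted_stirling)

lemma of_nat_add_neq_0:
  assumes "a \<notin> \<int>\<^sub>\<le>\<^sub>0"
  shows "of_nat m + a \<noteq> (0 :: 'a :: ring_char_0)"
  using assms by (metis add_eq_0_iff minus_of_nat_in_nonpos_Ints)

lemma hurwitz_poly_bernoulli_0:
  assumes "a \<notin> \<int>\<^sub>\<le>\<^sub>0"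
  shows "hurwitz_poly_bernoulli 0 m k a = 1 / a powi k"
  \<comment> \<open>The single summand m!/(m + a)^k cancels against the prefactor.\<close>
  using of_nat_add_neq_0[OF assms, of m]
  by (simp add: hurwitz_poly_bernoulli_eq_weighted_stirling weighted_stirling_0)

lemma hurwitz_poly_bernoulli_Suc:
  assumes "a \<notin> \<int>\<^sub>\<le>\<^sub>0"
  shows "hurwitz_poly_bernoulli (Suc n) m k a =
           of_nat (Suc m) * (of_nat m + a) powi k / (of_nat m + a + 1) powi k *
             hurwitz_poly_bernoulli n (Suc m) k a
           - of_nat m * hurwitz_poly_bernoulli n m k a"
proof -
  define c where "c i = fact (i + m) / (of_nat (i + m) + a) powi k" for i
  define p where "p = (of_nat m + a) powi k / (fact m * a powi k)"
  define S where "S = (\<Sum>i\<le>n. weighted_stirling n i (of_nat m) * ((-1) ^ (n - i) * c i))"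
  \<comment> \<open>Since \<open>c\<close> sees only i + m, the weight \<open>c (Suc i)\<close> is
    the one at index i for m + 1, so \<open>T\<close> is the inner sum at (n, m + 1).\<close>
  define T where
    "T = (\<Sum>i\<le>n. weighted_stirling n i (of_nat m + 1) * ((-1) ^ (n - i) * c (Suc i)))"
  have nz: "of_nat m + a + 1 \<noteq> 0"
    using of_nat_add_neq_0[OF assms, of "Suc m"] by (simp add: add_ac)
  have "hurwitz_poly_bernoulli (Suc n) m k a = p * (T - of_nat m * S)"
    unfolding hurwitz_poly_bernoulli_eq_weighted_stirling c_def[symmetric] p_def[symmetric]
      sum_weighted_stirling_Suc S_def T_def ..
  moreover have "hurwitz_poly_bernoulli n m k a = p * S"
    unfolding hurwitz_poly_bernoulli_eq_weighted_stirling c_def[symmetric] p_def[symmetric] S_def ..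
  moreover have "hurwitz_poly_bernoulli n (Suc m) k a =
      (of_nat m + a + 1) powi k / (fact (Suc m) * a powi k) * T"
    by (simp add: hurwitz_poly_bernoulli_eq_weighted_stirling T_def c_def add_ac)
  \<comment> \<open>The coefficient is chosen to turn the prefactor for m + 1 into \<open>p\<close>:
    m + 1 reduces (m + 1)! to m!, and the powers of m + a + 1 cancel.\<close>
  moreover have "of_nat (Suc m) * (of_nat m + a) powi k / (of_nat m + a + 1) powi k *
      ((of_nat m + a + 1) powi k / (fact (Suc m) * a powi k) * T) = p * T"
    using nz unfolding p_def fact_Suc by (simp del: of_nat_Suc)
  ultimately show ?thesis by (simp add: algebra_simps)
qed

theorem theorem2p3:
  fixes k :: int and a :: complex
  assumes "a \<notin> \<int>\<^sub>\<le>\<^sub>0"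
  shows "(\<forall>n m :: nat. hurwitz_poly_bernoulli (n + 1) m k a =
            (of_nat (m + 1) * (of_nat m + a) powi k / (of_nat m + a + 1) powi k) *
              hurwitz_poly_bernoulli n (m + 1) k a
            - of_nat m * hurwitz_poly_bernoulli n m k a)
       \<and> (\<forall>m :: nat. hurwitz_poly_bernoulli 0 m k a = 1 / a powi k)"
  using hurwitz_poly_bernoulli_Suc[OF assms] hurwitz_poly_bernoulli_0[OF assms]
  unfolding Suc_eq_plus1 by blast

end
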